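(* Let $(\vec\psi,\vec M)$ and $(\tilde{\vec\psi},\vec M)$ both satisfy the standing assumptions in the context, where $\tilde\psi_i=\psi_i$ for all $i\neq1$ (only the wisdom of agent $1$ is changed, from $\psi_1$ to $\tilde\psi_1$). Let $\bar P_1$ and $\tilde P_1$ denote the individual values of agent $1$ in the systems $(\vec\psi,\vec M)$ and $(\tilde{\vec\psi},\vec M)$ respectively. (i) If $\tilde\psi_1=\beta\psi_1$ for a constant $\beta>0$, then $\tilde P_1\ge\beta\bar P_1$ if $\beta>1$, and $\tilde P_1\le\beta\bar P_1$ if $\beta<1$. (ii) In the saturated and under-saturated cases ($\sum_{i\in I}M_i\le\mu(X)$), if $\tilde\psi_1=\psi_1+\lambda$ for a constant $\lambda>0$, then $\tilde P_1=\bar P_1+\lambda M_1$.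
   Context: Setting. $I=\{1,\ldots,N\}$; $X$ is a compact Hausdorff space; $\mu$ is a probability Borel measure on $X$; $\vec\psi=(\psi_1,\ldots,\psi_N)$ with each $\psi_i:X\to\mathbb R$ continuous ("wisdom" of agent $i$); $\vec M=(M_1,\ldots,M_N)$ with $M_i>0$ ("capacities"). Standing assumptions on a system $(\vec\psi,\vec M)$: (a) $\sum_{i\in I}\mu\{x;\psi_i(x)\le0\}=0$; (b) for any $r\in\mathbb R$ and any $i\ne j\in I$, $\mu\{x;\psi_i(x)-\psi_j(x)=r\}=0$; (c) in the under-saturated case $\sum_{i\in I} M_i<\mu(X)$, additionally $\mu\{x;\psi_i(x)=r\}=0$ for all $i\in I$ and all $r\in\mathbb R$. $\mathcal P_{\vec M}$ is the set of $\vec A=(A_1,\ldots,A_N)$ with $A_i\subset X$ measurable, $\mu(A_i)\le M_i$, and $\mu(A_i\cap A_j)=0$ for $i\ne j$. Under the standing assumptions there is a unique (up to $\mu$-null sets) optimal partition $(\bar A_1,\ldots,\bar A_N)\in\mathcal P_{\vec M}$, i.e. a maximizer of $\vec A\mapsto\sum_{i\in I}\int_{A_i}\psi_i\,d\mu$ over $\mathcal P_{\vec M}$. The individual value of agent $i$ in the system $(\vec\psi,\vec M)$ is $\bar P_i:=\int_{\bar A_i}\psi_i\,d\mu$. Likewise $\tilde P_1$ is $\int\tilde\psi_1\,d\mu$ over agent $1$'s share in the optimal partition of the system $(\tilde{\vec\psi},\vec M)$. The cases are: saturated $\sum_i M_i=\mu(X)$, under-saturated $\sum_i M_i<\mu(X)$,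 over-saturated $\sum_iM_i>\mu(X)$. *)

theory Defs
  imports "HOL-Probability.Probability_Measure"
begin

definition agents :: "nat \<Rightarrow> nat set" where
  "agents N = {1..N}"

definition total_capacity :: "nat \<Rightarrow> (nat \<Rightarrow> real) \<Rightarrow> real" where
  "total_capacity N M = (\<Sum>i\<in>agents N. M i)"

definition wisdom_system ::
  "nat \<Rightarrow> (nat \<Rightarrow> 'a::topological_space \<Rightarrow> real) \<Rightarrow> (nat \<Rightarrow> real) \<Rightarrow> bool" where
  "wisdom_system N \<psi> M \<longleftrightarrow>
     (\<forall>i\<in>agents N. continuous_on UNIV (\<psi> i)) \<and>
     (\<forall>i\<in>agents N. M i > 0)"

definition standing_assumptions ::
  "'a measure \<Rightarrow> nat \<Rightarrow> (nat \<Rightarrow> 'a \<Rightarrow> real) \<Rightarrow> (nat \<Rightarrow> real) \<Rightarrow> bool" where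
  "standing_assumptions \<mu> N \<psi> M \<longleftrightarrow>
     (\<Sum>i\<in>agents N. measure \<mu> {x \<in> space \<mu>. \<psi> i x \<le> 0}) = 0 \<and>
     (\<forall>r. \<forall>i\<in>agents N. \<forall>j\<in>agents N. i \<noteq> j \<longrightarrow>
        measure \<mu> {x \<in> space \<mu>. \<psi> i x - \<psi> j x = r} = 0) \<and>
     (total_capacity N M < measure \<mu> (space \<mu>) \<longrightarrow>
        (\<forall>i\<in>agents N. \<forall>r. measure \<mu> {x \<in> space \<mu>. \<psi> i x = r} = 0))"

text \<open>Only the components \<open>A i\<close> with \<open>i \<in> agents N\<close> are meaningful. The shares of distinct
  agents may overlap in null sets and need not cover the space.\<close>

definition partitions ::
  "'a measure \<Rightarrow> nat \<Rightarrow> (nat \<Rightarrow> real) \<Rightarrow> (nat \<Rightarrow> 'a set) set" where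
  "partitions \<mu> N M = {A.
     (\<forall>i\<in>agents N. A i \<in> sets \<mu> \<and> measure \<mu> (A i) \<le> M i) \<and>
     (\<forall>i\<in>agents N. \<forall>j\<in>agents N. i \<noteq> j \<longrightarrow> measure \<mu> (A i \<inter> A j) = 0)}"

definition individual_value ::
  "'a measure \<Rightarrow> (nat \<Rightarrow> 'a \<Rightarrow> real) \<Rightarrow> (nat \<Rightarrow> 'a set) \<Rightarrow> nat \<Rightarrow> real" where
  "individual_value \<mu> \<psi> A i = (LINT x:A i|\<mu>. \<psi> i x)"

definition optimal_partition ::
  "'a measure \<Rightarrow> nat \<Rightarrow> (nat \<Rightarrow> 'a \<Rightarrow> real) \<Rightarrow> (nat \<Rightarrow> real) \<Rightarrow> (nat \<Rightarrow> 'a set) \<Rightarrow> bool" where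
  "optimal_partition \<mu> N \<psi> M A \<longleftrightarrow>
     A \<in> partitions \<mu> N M \<and>
     (\<forall>B\<in>partitions \<mu> N M.
        (\<Sum>i\<in>agents N. individual_value \<mu> \<psi> B i) \<le> (\<Sum>i\<in>agents N. individual_value \<mu> \<psi> A i))"

end

(* Part (i) only compares the two optimality inequalities. For part (ii), every optimal partition
   exhausts the capacities, so adding a constant to psi_1 shifts the total value of both optimal
   partitions by the same amount, hence A' is optimal for psi as well, and it remains to see that
   optimal partitions are a.e. unique. Given two of them, let h be the gain of moving a point from its
   owner in the first to its owner in the second. Moving exactly the points at which h exceeds its
   median, taken separately on each set of points with a given pair of owners, produces a feasible
   competitor. Its value is the common optimum plus half the integral of the distance of h from these
   medians. So h equals its median a.e., which the no-tie assumption forbids unless the owners agree. *)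
theory Submission
  imports Defs "HOL-Probability.Distribution_Functions"
begin

section \<open>Sublevel sets of prescribed measure\<close>

text \<open>The distribution function of \<open>f\<close> on \<open>R\<close> jumps only by the
  measures of level sets, so it is continuous here; it runs from 0 to \<open>measure M R\<close>,
  and the intermediate value theorem applies. With \<open>c\<close> half the measure of
  \<open>R\<close>, this yields a median that splits \<open>R\<close> exactly.\<close>

lemma (in finite_measure) exists_sublevel_of_measure:
  fixes f :: "'a \<Rightarrow> real"
  assumes R[measurable]: "R \<in> sets M" and f[measurable]: "f \<in> borel_measurable M"
    and level: "\<And>r. measure M {x \<in> space M. x \<in> R \<and> f x = r} = 0"
    and c: "0 < c" "c < measure M R"
  shows "\<exists>t. measure M {x \<in> space M. x \<in> R \<and> f x \<le> t} = c"
proof -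
  have RS: "R \<subseteq> space M" using R sets.sets_into_space by blast
  let ?Q = "restrict_space M R"
  have fR[measurable]: "f \<in> borel_measurable ?Q" by (rule measurable_restrict_space1) fact
  have finR: "finite_measure ?Q"
    by (rule finite_measureI) (use R RS in \<open>auto simp: emeasure_restrict_space space_restrict_space emeasure_eq_measure\<close>)
  define D where "D = distr ?Q borel f"
  have meas: "measure D S = measure M {x \<in> space M. x \<in> R \<and> f x \<in> S}" if "S \<in> sets borel" for S
  proof -
    have "measure D S = measure ?Q (f -` S \<inter> space ?Q)"
      unfolding D_def using that by (intro measure_distr) auto
    also have "\<dots> = measure M (f -` S \<inter> space ?Q)"
      using R by (intro measure_restrict_space) (auto simp: space_restrict_space)
    also have "f -` S \<inter> space ?Q = {x \<in> space M. x \<in> R \<and> f x \<in> S}"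
      using RS by (auto simp: space_restrict_space)
    finally show ?thesis .
  qed
  interpret D: finite_borel_measure D
    unfolding finite_borel_measure_def finite_borel_measure_axioms_def
    using finite_measure.finite_measure_distr[OF finR fR] by (simp add: D_def)
  have cdf_eq: "cdf D t = measure M {x \<in> space M. x \<in> R \<and> f x \<le> t}" for t
    by (simp add: cdf_def meas)
  have tot: "measure D (space D) = measure M R"
  proof -
    have "{x \<in> space M. x \<in> R} = R" using RS by auto
    then show ?thesis using meas[of UNIV] by (simp add: D_def)
  qed
  have cont: "isCont (cdf D) t" for t
    using level[of t] by (simp add: D.isCont_cdf meas)
  have "eventually (\<lambda>t. cdf D t < c) at_bot"
    using D.cdf_lim_at_bot c(1) by (rule order_tendstoD)
  then obtain u where u: "cdf D u < c"
    by (auto simp: eventually_at_bot_linorder)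
  have "eventually (\<lambda>t. c < cdf D t) at_top"
    using D.cdf_lim_at_top c(2) unfolding tot by (rule order_tendstoD)
  then obtain v where v: "c < cdf D v"
    by (auto simp: eventually_at_top_linorder)
  have "u \<le> v"
    using u v D.cdf_nondecreasing[of v u] by linarith
  then have "\<exists>t. u \<le> t \<and> t \<le> v \<and> cdf D t = c"
    using u v cont by (intro IVT) auto
  then show ?thesis by (auto simp: cdf_eq)
qed

section \<open>The exchange argument for two assignments of owners\<close>

text \<open>Partitions are replaced by owner functions \<open>a\<close> and \<open>a'\<close>.
  Optimality enters only through competitors whose share sizes are the averages of those of
  \<open>a\<close> and \<open>a'\<close>. Ties need to be excluded only on the set where the two
  owners are the given pair, which leaves room for a dummy owner of a null set.\<close>

lemma (in finite_measure) AE_eq_of_balanced_exchange: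
  fixes \<phi> :: "'i::countable \<Rightarrow> 'a \<Rightarrow> real"
  assumes J: "finite J"
    and a[measurable]: "a \<in> measurable M (count_space UNIV)"
    and a'[measurable]: "a' \<in> measurable M (count_space UNIV)"
    and aJ: "\<And>x. x \<in> space M \<Longrightarrow> a x \<in> J" and a'J: "\<And>x. x \<in> space M \<Longrightarrow> a' x \<in> J"
    and \<phi>: "\<And>i. integrable M (\<phi> i)"
    and ties: "\<And>i j r. i \<in> J \<Longrightarrow> j \<in> J \<Longrightarrow> i \<noteq> j \<Longrightarrow>
      measure M {x \<in> space M. (a x = i \<and> a' x = j) \<and> \<phi> j x - \<phi> i x = r} = 0"
    and opt: "\<And>c. c \<in> measurable M (count_space UNIV) \<Longrightarrow>
      (\<And>i. measure M {x \<in> space M. c x = i} =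
         (measure M {x \<in> space M. a x = i} + measure M {x \<in> space M. a' x = i}) / 2) \<Longrightarrow>
      (LINT x|M. \<phi> (c x) x) \<le> ((LINT x|M. \<phi> (a x) x) + (LINT x|M. \<phi> (a' x) x)) / 2"
  shows "AE x in M. a x = a' x"
proof -
  have \<phi>m[measurable]: "\<phi> i \<in> borel_measurable M" for i
    using \<phi> by auto
  have int_comp: "integrable M (\<lambda>x. \<phi> (b x) x)"
    if b[measurable]: "b \<in> measurable M (count_space UNIV)"
      and bJ: "\<And>x. x \<in> space M \<Longrightarrow> b x \<in> J" for b
  proof -
    have "integrable M (\<lambda>x. \<Sum>i\<in>J. indicator {x \<in> space M. b x = i} x * \<phi> i x)"
      using integrable_mult_indicator[OF _ \<phi>]
      by (intro Bochner_Integration.integrable_sum) (simp only: real_scaleR_def[symmetric], auto)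
    moreover have "(\<Sum>i\<in>J. indicator {x \<in> space M. b x = i} x * \<phi> i x) = \<phi> (b x) x"
      if "x \<in> space M" for x
    proof -
      have "(\<Sum>i\<in>J. indicator {x \<in> space M. b x = i} x * \<phi> i x) =
        (\<Sum>i\<in>J. if b x = i then \<phi> i x else 0)"
        using that by (intro sum.cong) auto
      then show ?thesis using J bJ[OF that] by simp
    qed
    ultimately show ?thesis
      by (subst Bochner_Integration.integrable_cong[OF refl]) auto
  qed
  define B where "B i j = {x \<in> space M. a x = i \<and> a' x = j}" for i j
  have Bm[measurable]: "B i j \<in> sets M" for i j
    unfolding B_def by measurable
  have ex: "\<exists>t. measure M {x \<in> space M. x \<in> B i j \<and> \<phi> j x - \<phi> i x \<le> t} = measure M (B i j) / 2"
    if ij: "i \<in> J" "j \<in> J" "i \<noteq> j" for i j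
  \<comment> \<open>The sublevel lemma needs a target strictly between 0 and the full measure. On a
    null block every threshold works, and 0 is taken.\<close>
  proof (cases "measure M (B i j) = 0")
    case True
    have "measure M {x \<in> space M. x \<in> B i j \<and> \<phi> j x - \<phi> i x \<le> 0} \<le> measure M (B i j)"
      by (intro finite_measure_mono) auto
    with True show ?thesis by (intro exI[of _ 0]) (simp add: measure_le_0_iff)
  next
    case False
    have "{x \<in> space M. x \<in> B i j \<and> \<phi> j x - \<phi> i x = r} =
        {x \<in> space M. (a x = i \<and> a' x = j) \<and> \<phi> j x - \<phi> i x = r}" for r
      by (auto simp: B_def)
    moreover have "0 < measure M (B i j)"
      using False by (simp add: zero_less_measure_iff)
    ultimately show ?thesis
      using ties[OF ij] by (intro exists_sublevel_of_measure) auto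
  qed
  define t0 where "t0 i j = (SOME t. measure M {x \<in> space M. x \<in> B i j \<and> \<phi> j x - \<phi> i x \<le> t} =
      measure M (B i j) / 2)" for i j
  have t0: "measure M {x \<in> space M. x \<in> B i j \<and> \<phi> j x - \<phi> i x \<le> t0 i j} = measure M (B i j) / 2"
    if "i \<in> J" "j \<in> J" "i \<noteq> j" for i j
    unfolding t0_def using ex[OF that] by (rule someI_ex)
  \<comment> \<open>Where the owners agree, \<open>h\<close> vanishes, so the threshold 0 gives no
    deviation there. It also makes \<open>t\<close> vanish on the diagonal, as
    \<open>\<sigma>_w\<close> requires.\<close>
  define t where "t i j = (if i = j then 0 else t0 i j)" for i j
  define h where "h x = \<phi> (a' x) x - \<phi> (a x) x" for x
  have \<phi>a[measurable]: "(\<lambda>x. \<phi> (a x) x) \<in> borel_measurable M" "(\<lambda>x. \<phi> (a' x) x) \<in> borel_measurable M"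
    using int_comp[OF a aJ] int_comp[OF a' a'J] by auto
  have [measurable]: "h \<in> borel_measurable M"
    unfolding h_def by measurable
  \<comment> \<open>A function of the pair of owners is a finite combination of block indicators.
    Its measurability, its integrability and its integral against \<open>\<sigma>\<close> all follow
    from this.\<close>
  have w_sum: "w (a x) (a' x) = (\<Sum>i\<in>J. \<Sum>j\<in>J. w i j * indicator (B i j) x)"
    if "x \<in> space M" for x and w :: "'i \<Rightarrow> 'i \<Rightarrow> real"
  proof -
    have "(\<Sum>i\<in>J. \<Sum>j\<in>J. w i j * indicator (B i j) x) =
        (\<Sum>i\<in>J. \<Sum>j\<in>J. if a' x = j then (if a x = i then w i j else 0) else 0)"
      using that by (intro sum.cong) (auto simp: B_def)
    also have "\<dots> = (\<Sum>i\<in>J. if a x = i then w i (a' x) else 0)"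
      using J a'J[OF that] by (intro sum.cong) auto
    also have "\<dots> = w (a x) (a' x)"
      using J aJ[OF that] by simp
    finally show ?thesis ..
  qed
  have wm[measurable]: "(\<lambda>x. w (a x) (a' x)) \<in> borel_measurable M" for w :: "'i \<Rightarrow> 'i \<Rightarrow> real"
    by (subst measurable_cong[OF w_sum]) auto
  \<comment> \<open>The sign is +1 where the point is moved and -1 where it stays. The value -1 at
    equality matches the non-strict sublevel sets defining \<open>t0\<close>, so off the diagonal
    each block is split into two halves of equal measure.\<close>
  define \<sigma> :: "'a \<Rightarrow> real" where "\<sigma> x = (if t (a x) (a' x) < h x then 1 else -1)" for x
  have \<sigma>m[measurable]: "\<sigma> \<in> borel_measurable M"
    unfolding \<sigma>_def by measurable
  have \<sigma>_int: "integrable M (\<lambda>x. \<sigma> x * f x)" if "integrable M f" for f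
  proof (rule Bochner_Integration.integrable_bound[OF that])
    show "(\<lambda>x. \<sigma> x * f x) \<in> borel_measurable M" using that by auto
  qed (auto simp: \<sigma>_def)
  have ind_int: "integrable M (\<lambda>x. indicator (B i j) x :: real)" for i j
    by (intro integrable_real_indicator) (auto simp: emeasure_eq_measure)
  have w_int: "integrable M (\<lambda>x. w (a x) (a' x))" for w :: "'i \<Rightarrow> 'i \<Rightarrow> real"
    by (subst Bochner_Integration.integrable_cong[OF refl w_sum], assumption)
      (intro Bochner_Integration.integrable_sum integrable_mult_right ind_int)
  have \<sigma>_B: "(LINT x|M. \<sigma> x * indicator (B i j) x) = 0" if ij: "i \<in> J" "j \<in> J" "i \<noteq> j" for i j
  proof -
    let ?L = "{x \<in> space M. x \<in> B i j \<and> \<phi> j x - \<phi> i x \<le> t0 i j}"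
    have "(LINT x|M. \<sigma> x * indicator (B i j) x) = (LINT x|M. indicator (B i j) x - 2 * indicator ?L x)"
    proof (intro Bochner_Integration.integral_cong refl)
      fix x assume x: "x \<in> space M"
      show "\<sigma> x * indicator (B i j) x = indicator (B i j) x - 2 * indicator ?L x"
      proof (cases "x \<in> B i j")
        case True
        then have "a x = i" "a' x = j" by (simp_all add: B_def)
        with True x ij(3) show ?thesis by (simp add: \<sigma>_def h_def t_def indicator_def)
      qed (simp add: indicator_def)
    qed
    also have "\<dots> = measure M (B i j) - 2 * measure M ?L"
    proof (subst Bochner_Integration.integral_diff)
      show "integrable M (\<lambda>x. 2 * indicator ?L x :: real)"
        by (intro integrable_mult_right integrable_real_indicator) (auto simp: emeasure_eq_measure)
      show "(LINT x|M. indicator (B i j) x) - (LINT x|M. 2 * indicator ?L x) =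
          measure M (B i j) - 2 * measure M ?L"
        by (simp add: Int_absorb2 sets.sets_into_space)
    qed (rule ind_int)
    finally show ?thesis using t0 ij by simp
  qed
  have \<sigma>_w: "(LINT x|M. \<sigma> x * w (a x) (a' x)) = 0"
    if w: "\<And>i. w i i = 0" for w :: "'i \<Rightarrow> 'i \<Rightarrow> real"
  proof -
    have "(LINT x|M. \<sigma> x * w (a x) (a' x)) =
        (LINT x|M. (\<Sum>i\<in>J. \<Sum>j\<in>J. w i j * (\<sigma> x * indicator (B i j) x)))"
      by (intro Bochner_Integration.integral_cong refl, subst w_sum)
        (auto simp: sum_distrib_left mult_ac)
    also have "\<dots> = (\<Sum>i\<in>J. \<Sum>j\<in>J. w i j * (LINT x|M. \<sigma> x * indicator (B i j) x))"
      by (simp add: \<sigma>_int[OF ind_int])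
    also have "\<dots> = 0"
      by (intro sum.neutral ballI) (metis \<sigma>_B w mult_zero_left mult_zero_right)
    finally show ?thesis .
  qed
  define c where "c x = (if t (a x) (a' x) < h x then a' x else a x)" for x
  have cm[measurable]: "c \<in> measurable M (count_space UNIV)"
    unfolding c_def by measurable
  have h_int: "integrable M h"
    unfolding h_def by (intro Bochner_Integration.integrable_diff int_comp a a' aJ a'J)
  have "measure M {x \<in> space M. c x = i} =
      (measure M {x \<in> space M. a x = i} + measure M {x \<in> space M. a' x = i}) / 2" for i
  proof -
    have ind: "integrable M (\<lambda>x. of_bool (b x = i) :: real)"
      "(LINT x|M. of_bool (b x = i)) = measure M {x \<in> space M. b x = i}"
      if [measurable]: "b \<in> measurable M (count_space UNIV)" for b
    proof -
      have eq: "of_bool (b x = i) = (indicator {x \<in> space M. b x = i} x :: real)" if "x \<in> space M" for x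
        using that by auto
      show "integrable M (\<lambda>x. of_bool (b x = i) :: real)"
        by (subst Bochner_Integration.integrable_cong[OF refl eq])
          (auto intro!: integrable_real_indicator simp: emeasure_eq_measure)
      show "(LINT x|M. of_bool (b x = i)) = measure M {x \<in> space M. b x = i}"
        by (subst Bochner_Integration.integral_cong[OF refl eq]) (auto intro!: arg_cong[where f="measure M"])
    qed
    \<comment> \<open>This is the change in the holdings of \<open>i\<close> when a point passes
      from owner \<open>k\<close> to owner \<open>l\<close>. It is 0 on the diagonal, so its
      integral against \<open>\<sigma>\<close> vanishes and the competitor has exactly the average
      share sizes.\<close>
    let ?w = "\<lambda>k l. of_bool (l = i) - of_bool (k = i) :: real"
    have "measure M {x \<in> space M. c x = i} =
        (LINT x|M. (of_bool (a x = i) + of_bool (a' x = i) + \<sigma> x * ?w (a x) (a' x)) / 2)"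
      unfolding ind(2)[OF cm, symmetric]
      by (intro Bochner_Integration.integral_cong) (auto simp: c_def \<sigma>_def)
    also have "\<dots> = ((LINT x|M. of_bool (a x = i)) + (LINT x|M. of_bool (a' x = i)) +
        (LINT x|M. \<sigma> x * ?w (a x) (a' x))) / 2"
      using ind(1)[OF a] ind(1)[OF a'] \<sigma>_int[OF w_int, of ?w] by simp
    finally show ?thesis
      using \<sigma>_w[of ?w] ind(2)[OF a] ind(2)[OF a'] by simp
  qed
  from opt[OF cm this]
  have le: "(LINT x|M. \<phi> (c x) x) \<le> ((LINT x|M. \<phi> (a x) x) + (LINT x|M. \<phi> (a' x) x)) / 2" .
  have "(LINT x|M. \<phi> (c x) x) = (LINT x|M. (\<phi> (a x) x + \<phi> (a' x) x + \<sigma> x * h x) / 2)"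
    by (intro Bochner_Integration.integral_cong) (auto simp: c_def \<sigma>_def h_def field_simps)
  also have "\<dots> = ((LINT x|M. \<phi> (a x) x) + (LINT x|M. \<phi> (a' x) x) + (LINT x|M. \<sigma> x * h x)) / 2"
    using int_comp[OF a aJ] int_comp[OF a' a'J] \<sigma>_int[OF h_int] by simp
  finally have \<sigma>h: "(LINT x|M. \<sigma> x * h x) \<le> 0"
    using le by simp
  let ?d = "\<lambda>x. \<bar>h x - t (a x) (a' x)\<bar>"
  have d_int: "integrable M ?d"
    using h_int w_int[of t] by auto
  \<comment> \<open>By the choice of the sign, the distance of \<open>h\<close> from
    \<open>t\<close> is \<open>\<sigma>\<close> times their difference. The \<open>t\<close> part
    integrates to 0, and the \<open>h\<close> part is at most 0 by optimality.\<close>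
  have "(LINT x|M. ?d x) = (LINT x|M. \<sigma> x * h x - \<sigma> x * t (a x) (a' x))"
    by (intro Bochner_Integration.integral_cong) (auto simp: \<sigma>_def)
  also have "\<dots> = (LINT x|M. \<sigma> x * h x)"
    using \<sigma>_int[OF h_int] \<sigma>_int[OF w_int[of t]] \<sigma>_w[of t] by (simp add: t_def)
  finally have "(LINT x|M. ?d x) \<le> 0"
    using \<sigma>h by simp
  moreover have "0 \<le> (LINT x|M. ?d x)"
    by (rule Bochner_Integration.integral_nonneg) simp
  ultimately have "(LINT x|M. ?d x) = 0"
    by (rule antisym)
  then have "AE x in M. ?d x = 0"
    using integral_nonneg_eq_0_iff_AE[OF d_int] by auto
  then have AE_ht: "AE x in M. h x = t (a x) (a' x)"
    by auto
  \<comment> \<open>Equality of \<open>h\<close> with its median on an off-diagonal block is a tie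
    at the level \<open>t i j\<close>, hence occurs only on a null set.\<close>
  have "AE x in M. i \<noteq> j \<longrightarrow> \<not> ((a x = i \<and> a' x = j) \<and> \<phi> j x - \<phi> i x = t i j)"
    if "i \<in> J" "j \<in> J" for i j
  proof (cases "i = j")
    case False
    show ?thesis
      using ties[OF that False, of "t i j"]
      by (intro AE_I[where N="{x \<in> space M. (a x = i \<and> a' x = j) \<and> \<phi> j x - \<phi> i x = t i j}"])
        (auto simp: emeasure_eq_measure)
  qed simp
  then have "AE x in M. \<forall>i\<in>J. \<forall>j\<in>J. i \<noteq> j \<longrightarrow>
      \<not> ((a x = i \<and> a' x = j) \<and> \<phi> j x - \<phi> i x = t i j)"
    by (intro AE_finite_allI[OF J])
  with AE_ht AE_space show ?thesis
  proof eventually_elim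
    case (elim x)
    then show ?case using aJ[of x] a'J[of x] by (auto simp: h_def)
  qed
qed

section \<open>Partitions as owner functions\<close>

text \<open>The dummy agent \<open>Suc N\<close> owns the points that nobody else owns.\<close>

definition owner :: "nat \<Rightarrow> (nat \<Rightarrow> 'a set) \<Rightarrow> 'a \<Rightarrow> nat" where
  "owner N A x = (LEAST i. i \<in> agents N \<and> x \<in> A i \<or> i = Suc N)"

lemma finite_agents [simp]: "finite (agents N)"
  by (simp add: agents_def)

lemma owner_cases: "owner N A x \<in> agents N \<and> x \<in> A (owner N A x) \<or> owner N A x = Suc N"
  unfolding owner_def by (rule LeastI[where k="Suc N"]) simp

lemma owner_measurable:
  assumes "\<And>i. i \<in> agents N \<Longrightarrow> A i \<in> sets \<mu>"
  shows "owner N A \<in> measurable \<mu> (count_space UNIV)"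
proof -
  have "(\<lambda>x. i \<in> agents N \<and> x \<in> A i \<or> i = Suc N) \<in> measurable \<mu> (count_space UNIV)" for i
  proof (cases "i \<in> agents N")
    case True
    then have [measurable]: "A i \<in> sets \<mu>" by (rule assms)
    show ?thesis by measurable
  qed simp
  then show ?thesis
    unfolding owner_def[abs_def] by (rule measurable_Least)
qed

text \<open>Off the finitely many null overlaps, a point lies in at most one share. Since
  \<open>Suc N\<close> exceeds every agent, the least candidate is that share's agent if there is
  one, and the dummy only otherwise.\<close>

lemma AE_mem_iff_owner:
  assumes "finite_measure \<mu>" and A: "A \<in> partitions \<mu> N M"
  shows "AE x in \<mu>. \<forall>i\<in>agents N. x \<in> A i \<longleftrightarrow> owner N A x = i"
proof -
  interpret finite_measure \<mu> by fact
  have "AE x in \<mu>. \<not> (x \<in> A i \<and> x \<in> A j)" if "i \<in> agents N" "j \<in> agents N" "i \<noteq> j" for i j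
    using A that
    by (intro AE_I[where N="A i \<inter> A j"]) (auto simp: partitions_def emeasure_eq_measure)
  then have "AE x in \<mu>. \<forall>i\<in>agents N. \<forall>j\<in>agents N. i \<noteq> j \<longrightarrow> \<not> (x \<in> A i \<and> x \<in> A j)"
    by (auto intro!: AE_finite_allI)
  then show ?thesis
  proof eventually_elim
    case (elim x)
    have "owner N A x \<le> i" if "i \<in> agents N" "x \<in> A i" for i
      unfolding owner_def using that by (intro Least_le) auto
    moreover have "Suc N \<notin> agents N" "\<And>i. i \<in> agents N \<Longrightarrow> i \<le> N"
      by (auto simp: agents_def)
    ultimately show ?case
      using elim owner_cases[of N A x] by (metis Suc_n_not_le_n order_trans)
  qed
qed

lemma measure_owner:
  assumes "finite_measure \<mu>" and A: "A \<in> partitions \<mu> N M" and i: "i \<in> agents N"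
  shows "measure \<mu> {x \<in> space \<mu>. owner N A x = i} = measure \<mu> (A i)"
proof -
  have [measurable]: "owner N A \<in> measurable \<mu> (count_space UNIV)" "A i \<in> sets \<mu>"
    using A i by (auto intro!: owner_measurable simp: partitions_def)
  have "AE x in \<mu>. x \<in> {x \<in> space \<mu>. owner N A x = i} \<longleftrightarrow> x \<in> A i"
    using AE_mem_iff_owner[OF assms(1,2)] AE_space by eventually_elim (use i in auto)
  then show ?thesis
    by (intro measure_eq_AE) auto
qed

text \<open>The dummy agent has wisdom 0, so unowned points add nothing to the total value.\<close>

definition extended_wisdom :: "nat \<Rightarrow> (nat \<Rightarrow> 'a \<Rightarrow> real) \<Rightarrow> nat \<Rightarrow> 'a \<Rightarrow> real" where
  "extended_wisdom N \<psi> i x = (if i \<in> agents N then \<psi> i x else 0)"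

text \<open>The total value becomes one integral along the owner function. An arbitrary
  \<open>b\<close> is allowed because the formula serves both \<open>owner\<close> and the
  competitor in the exchange argument.\<close>

lemma total_value_eq_integral:
  fixes \<psi> :: "nat \<Rightarrow> 'a \<Rightarrow> real"
  assumes \<psi>: "\<And>i. i \<in> agents N \<Longrightarrow> integrable \<mu> (\<psi> i)"
    and b: "AE x in \<mu>. \<forall>i\<in>agents N. x \<in> B i \<longleftrightarrow> b x = i"
    and bm: "b \<in> measurable \<mu> (count_space UNIV)"
    and B: "\<And>i. i \<in> agents N \<Longrightarrow> B i \<in> sets \<mu>"
  shows "(\<Sum>i\<in>agents N. individual_value \<mu> \<psi> B i) = (LINT x|\<mu>. extended_wisdom N \<psi> (b x) x)"
proof -
  have ewm [measurable]: "extended_wisdom N \<psi> i \<in> borel_measurable \<mu>" for i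
    using \<psi>[of i] by (cases "i \<in> agents N") (auto simp: extended_wisdom_def[abs_def])
  have "(\<Sum>i\<in>agents N. individual_value \<mu> \<psi> B i) =
      (LINT x|\<mu>. (\<Sum>i\<in>agents N. indicator (B i) x * \<psi> i x))"
    unfolding individual_value_def set_lebesgue_integral_def
    using integrable_mult_indicator[OF B \<psi>]
    by (subst Bochner_Integration.integral_sum) auto
  also have "\<dots> = (LINT x|\<mu>. extended_wisdom N \<psi> (b x) x)"
  proof (intro integral_cong_AE)
    show "(\<lambda>x. \<Sum>i\<in>agents N. indicator (B i) x * \<psi> i x) \<in> borel_measurable \<mu>"
      using B \<psi> by (intro borel_measurable_sum borel_measurable_times) auto
    show "(\<lambda>x. extended_wisdom N \<psi> (b x) x) \<in> borel_measurable \<mu>"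
      by (rule measurable_compose_countable[OF ewm bm])
    show "AE x in \<mu>. (\<Sum>i\<in>agents N. indicator (B i) x * \<psi> i x) = extended_wisdom N \<psi> (b x) x"
      using b
    proof eventually_elim
      case (elim x)
      have "(\<Sum>i\<in>agents N. indicator (B i) x * \<psi> i x) = (\<Sum>i\<in>agents N. if b x = i then \<psi> i x else 0)"
        using elim by (intro sum.cong) (auto simp: indicator_def)
      then show ?case by (simp add: extended_wisdom_def)
    qed
  qed
  finally show ?thesis .
qed

section \<open>Optimal partitions exhaust the capacities\<close>

lemma standing_assumptions_AE_pos:
  assumes "finite_measure \<mu>" and st: "standing_assumptions \<mu> N \<psi> M" and i: "i \<in> agents N"
    and [measurable]: "\<psi> i \<in> borel_measurable \<mu>"
  shows "AE x in \<mu>. 0 < \<psi> i x"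
proof -
  interpret finite_measure \<mu> by fact
  have "measure \<mu> {x \<in> space \<mu>. \<psi> i x \<le> 0} = 0"
    using st i unfolding standing_assumptions_def by (subst (asm) sum_nonneg_eq_0_iff) auto
  then show ?thesis
    by (intro AE_I[where N="{x \<in> space \<mu>. \<psi> i x \<le> 0}"]) (auto simp: emeasure_eq_measure)
qed

text \<open>If agent \<open>i\<close> had spare capacity, the shares could not cover the space, and
  a piece of the unowned set \<open>R\<close> could be given to \<open>i\<close>. Positivity of
  \<open>\<psi> i\<close> almost everywhere would make this a strict improvement.\<close>

lemma optimal_partition_exhausts_capacity:
  assumes "finite_measure \<mu>"
    and \<psi>: "\<And>i. i \<in> agents N \<Longrightarrow> integrable \<mu> (\<psi> i)"
    and st: "standing_assumptions \<mu> N \<psi> M"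
    and opt: "optimal_partition \<mu> N \<psi> M A"
    and tot: "total_capacity N M \<le> measure \<mu> (space \<mu>)"
    and i: "i \<in> agents N"
  shows "measure \<mu> (A i) = M i"
proof (rule ccontr)
  interpret finite_measure \<mu> by fact
  have [measurable]: "j \<in> agents N \<Longrightarrow> \<psi> j \<in> borel_measurable \<mu>" for j
    using \<psi> by auto
  have Ap: "A \<in> partitions \<mu> N M" using opt by (simp add: optimal_partition_def)
  then have Am: "\<And>j. j \<in> agents N \<Longrightarrow> A j \<in> sets \<mu>" and Ale: "\<And>j. j \<in> agents N \<Longrightarrow> measure \<mu> (A j) \<le> M j"
    by (auto simp: partitions_def)
  assume "measure \<mu> (A i) \<noteq> M i"
  with Ale[OF i] have lt: "measure \<mu> (A i) < M i" by simp
  define R where "R = space \<mu> - (\<Union>j\<in>agents N. A j)"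
  have U: "(\<Union>j\<in>agents N. A j) \<in> sets \<mu>" using Am by auto
  have Rm[measurable]: "R \<in> sets \<mu>" unfolding R_def using U by auto
  have Rmeas: "measure \<mu> R = measure \<mu> (space \<mu>) - measure \<mu> (\<Union>j\<in>agents N. A j)"
    unfolding R_def using U by (rule finite_measure_compl)
  have "measure \<mu> (\<Union>j\<in>agents N. A j) \<le> (\<Sum>j\<in>agents N. measure \<mu> (A j))"
    using Am by (intro measure_UNION_le) auto
  also have "\<dots> < (\<Sum>j\<in>agents N. M j)"
    using Ale lt i by (intro sum_strict_mono_ex1) auto
  finally have Rpos: "0 < measure \<mu> R"
    using tot Rmeas by (simp add: total_capacity_def)
  have slice: "\<exists>T\<in>sets \<mu>. T \<subseteq> R \<and> 0 < measure \<mu> T \<and> measure \<mu> T \<le> M i - measure \<mu> (A i)"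
    if [measurable]: "f \<in> borel_measurable \<mu>"
      and level: "\<And>r. measure \<mu> {x \<in> space \<mu>. f x = r} = 0" for f :: "'a \<Rightarrow> real"
  proof -
    \<comment> \<open>Halving keeps the target strictly below the measure of \<open>R\<close>, as
      the sublevel lemma demands, and within the spare capacity.\<close>
    let ?c = "min (measure \<mu> R) (M i - measure \<mu> (A i)) / 2"
    have "measure \<mu> {x \<in> space \<mu>. x \<in> R \<and> f x = r} \<le> measure \<mu> {x \<in> space \<mu>. f x = r}" for r
      by (intro finite_measure_mono) auto
    from this have lv: "measure \<mu> {x \<in> space \<mu>. x \<in> R \<and> f x = r} = 0" for r
      by (simp only: level measure_le_0_iff)
    have c: "0 < ?c" "?c < measure \<mu> R" "?c \<le> M i - measure \<mu> (A i)" using Rpos lt by auto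
    obtain t where "measure \<mu> {x \<in> space \<mu>. x \<in> R \<and> f x \<le> t} = ?c"
      using exists_sublevel_of_measure[OF Rm _ lv c(1,2)] by auto
    then show ?thesis
      using c by (intro bexI[of _ "{x \<in> space \<mu>. x \<in> R \<and> f x \<le> t}"]) auto
  qed
  \<comment> \<open>Slicing needs a function with null level sets: \<open>\<psi> i\<close> itself in
    the under-saturated case, the difference of two wisdoms in the saturated case with at least two
    agents.\<close>
  have "\<exists>T\<in>sets \<mu>. T \<subseteq> R \<and> 0 < measure \<mu> T \<and> measure \<mu> T \<le> M i - measure \<mu> (A i)"
  proof (cases "total_capacity N M < measure \<mu> (space \<mu>)")
    case True
    with st i show ?thesis
      by (intro slice[of "\<psi> i"]) (auto simp: standing_assumptions_def)
  next
    case sat: False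
    show ?thesis
    proof (cases "agents N = {i}")
      case True
      \<comment> \<open>A single saturated agent has no tie condition, so \<open>\<mu>\<close> may have atoms; but then all of
        \<open>R\<close> fits into the spare capacity.\<close>
      then show ?thesis
        using sat tot Rmeas Rpos by (intro bexI[of _ R]) (auto simp: total_capacity_def)
    next
      case False
      then obtain j where "j \<in> agents N" "i \<noteq> j" using i by auto
      with st i show ?thesis
        by (intro slice[of "\<lambda>x. \<psi> i x - \<psi> j x"]) (auto simp: standing_assumptions_def)
    qed
  qed
  then obtain T where T: "T \<in> sets \<mu>" "T \<subseteq> R" "0 < measure \<mu> T" "measure \<mu> T \<le> M i - measure \<mu> (A i)"
    by auto
  have disj: "A j \<inter> T = {}" if "j \<in> agents N" for j
    using T(2) that by (auto simp: R_def)
  let ?B = "A(i := A i \<union> T)"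
  have "measure \<mu> (A i \<union> T) = measure \<mu> (A i) + measure \<mu> T"
    using Am[OF i] T(1) disj[OF i] by (intro finite_measure_Union) auto
  then have mB: "measure \<mu> (A i \<union> T) \<le> M i" using T(4) by simp
  have "?B j \<inter> ?B k = A j \<inter> A k" if "j \<in> agents N" "k \<in> agents N" "j \<noteq> k" for j k
    using disj that by auto
  then have Bp: "?B \<in> partitions \<mu> N M"
    using Ap T(1) mB i by (auto simp: partitions_def)
  have si: "set_integrable \<mu> S (\<psi> i)" if "S \<in> sets \<mu>" for S
    unfolding set_integrable_def using integrable_mult_indicator[OF that \<psi>[OF i]] .
  have "individual_value \<mu> \<psi> ?B i = individual_value \<mu> \<psi> A i + (LINT x:T|\<mu>. \<psi> i x)"
    unfolding individual_value_def fun_upd_same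
    using disj[OF i] Am[OF i] T(1) by (intro set_integral_Un si) auto
  moreover have "(\<Sum>j\<in>agents N - {i}. individual_value \<mu> \<psi> ?B j) =
      (\<Sum>j\<in>agents N - {i}. individual_value \<mu> \<psi> A j)"
    by (intro sum.cong) (auto simp: individual_value_def)
  moreover have "(\<Sum>j\<in>agents N. individual_value \<mu> \<psi> ?B j) \<le> (\<Sum>j\<in>agents N. individual_value \<mu> \<psi> A j)"
    using opt Bp unfolding optimal_partition_def by blast
  \<comment> \<open>All other terms cancel, so the value gained on \<open>T\<close> cannot be
    positive. As the integrand is positive on \<open>T\<close> almost everywhere, \<open>T\<close>
    must be null, a contradiction.\<close>
  ultimately have le: "(LINT x:T|\<mu>. \<psi> i x) \<le> 0"
    using i by (simp add: sum.remove[of _ i])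
  have pos: "AE x in \<mu>. 0 < \<psi> i x"
    using \<psi>[OF i] by (intro standing_assumptions_AE_pos[OF assms(1) st i]) auto
  have nn: "AE x in \<mu>. 0 \<le> indicator T x *\<^sub>R \<psi> i x"
    using pos by eventually_elim (auto simp: indicator_def)
  have "(LINT x|\<mu>. indicator T x *\<^sub>R \<psi> i x) = 0"
    using le integral_nonneg_AE[OF nn] by (simp add: set_lebesgue_integral_def)
  then have "AE x in \<mu>. indicator T x *\<^sub>R \<psi> i x = 0"
    using integral_nonneg_eq_0_iff_AE[OF si[OF T(1), unfolded set_integrable_def] nn] by simp
  then have "AE x in \<mu>. x \<notin> T"
    using pos by eventually_elim (auto simp: indicator_def)
  then have "measure \<mu> T = measure \<mu> {}"
    using T(1) by (intro measure_eq_AE) auto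
  with T(3) show False by simp
qed

section \<open>Uniqueness of optimal partitions\<close>

text \<open>The exchange lemma is applied to the two owner functions with the dummy included. Ties
  between agents are null by assumption; a tie with the dummy is a level set of a single wisdom,
  null when under-saturated, while in the saturated case the dummy owns only a null set.\<close>

lemma optimal_partitions_AE_eq:
  assumes "finite_measure \<mu>"
    and \<psi>: "\<And>i. i \<in> agents N \<Longrightarrow> integrable \<mu> (\<psi> i)"
    and st: "standing_assumptions \<mu> N \<psi> M"
    and opt: "optimal_partition \<mu> N \<psi> M A" "optimal_partition \<mu> N \<psi> M A'"
    and tot: "total_capacity N M \<le> measure \<mu> (space \<mu>)"
  shows "AE x in \<mu>. \<forall>i\<in>agents N. x \<in> A i \<longleftrightarrow> x \<in> A' i"
proof -
  interpret finite_measure \<mu> by fact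
  let ?J = "insert (Suc N) (agents N)"
  let ?\<phi> = "extended_wisdom N \<psi>"
  have dummy: "Suc N \<notin> agents N" by (simp add: agents_def)
  have p: "A \<in> partitions \<mu> N M" "A' \<in> partitions \<mu> N M"
    using opt by (auto simp: optimal_partition_def)
  have ow[measurable]: "owner N C \<in> measurable \<mu> (count_space UNIV)" if "C \<in> partitions \<mu> N M" for C
    using that by (intro owner_measurable) (auto simp: partitions_def)
  note [measurable] = ow[OF p(1)] ow[OF p(2)]
  have val: "(\<Sum>i\<in>agents N. individual_value \<mu> \<psi> C i) = (LINT x|\<mu>. ?\<phi> (owner N C x) x)"
    if "C \<in> partitions \<mu> N M" for C
    using that \<psi> by (intro total_value_eq_integral AE_mem_iff_owner[OF assms(1)] ow)
      (auto simp: partitions_def)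
  have \<phi>int: "integrable \<mu> (?\<phi> i)" for i
    using \<psi>[of i] by (cases "i \<in> agents N") (auto simp: extended_wisdom_def[abs_def])
  have [measurable]: "?\<phi> i \<in> borel_measurable \<mu>" for i
    using \<phi>int by auto
  \<comment> \<open>Here the capacities sum to the whole measure and are exhausted, so nothing
    remains for the dummy.\<close>
  have dummy_null: "measure \<mu> {x \<in> space \<mu>. owner N C x = Suc N} = 0"
    if sat: "\<not> total_capacity N M < measure \<mu> (space \<mu>)" and C: "optimal_partition \<mu> N \<psi> M C" for C
  proof -
    have Cp: "C \<in> partitions \<mu> N M" using C by (simp add: optimal_partition_def)
    note [measurable] = ow[OF Cp]
    have "measure \<mu> (\<Union>i\<in>?J. {x \<in> space \<mu>. owner N C x = i}) =
        (\<Sum>i\<in>?J. measure \<mu> {x \<in> space \<mu>. owner N C x = i})"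
      by (intro finite_measure_finite_Union) (auto simp: disjoint_family_on_def)
    also have "(\<Union>i\<in>?J. {x \<in> space \<mu>. owner N C x = i}) = space \<mu>"
      using owner_cases[of N C] by auto
    also have "(\<Sum>i\<in>?J. measure \<mu> {x \<in> space \<mu>. owner N C x = i}) =
        measure \<mu> {x \<in> space \<mu>. owner N C x = Suc N} + (\<Sum>i\<in>agents N. M i)"
      using dummy measure_owner[OF assms(1) Cp]
        optimal_partition_exhausts_capacity[OF assms(1) \<psi> st C tot] by simp
    finally show ?thesis
      using sat tot unfolding total_capacity_def by linarith
  qed
  have "AE x in \<mu>. owner N A x = owner N A' x"
  proof (rule AE_eq_of_balanced_exchange[where J="?J" and \<phi>="?\<phi>"])
    fix i j r assume ij: "i \<in> ?J" "j \<in> ?J" "i \<noteq> j"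
    let ?T = "{x \<in> space \<mu>. (owner N A x = i \<and> owner N A' x = j) \<and> ?\<phi> j x - ?\<phi> i x = r}"
    have sub: "measure \<mu> ?T = 0" if "?T \<subseteq> S" "S \<in> sets \<mu>" "measure \<mu> S = 0" for S
      using finite_measure_mono[OF that(1,2)] unfolding that(3) measure_le_0_iff .
    show "measure \<mu> ?T = 0"
    proof (cases "i \<in> agents N \<and> j \<in> agents N")
      case True
      with \<psi> have [measurable]: "\<psi> i \<in> borel_measurable \<mu>" "\<psi> j \<in> borel_measurable \<mu>" by auto
      have "?T \<subseteq> {x \<in> space \<mu>. \<psi> j x - \<psi> i x = r}"
        using True by (auto simp: extended_wisdom_def)
      moreover have "measure \<mu> {x \<in> space \<mu>. \<psi> j x - \<psi> i x = r} = 0"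
        using st True ij(3) unfolding standing_assumptions_def by metis
      ultimately show ?thesis
        by (intro sub[of "{x \<in> space \<mu>. \<psi> j x - \<psi> i x = r}"]) measurable
    next
      case False
      show ?thesis
      proof (cases "total_capacity N M < measure \<mu> (space \<mu>)")
        case True
        \<comment> \<open>Exactly one of \<open>i\<close> and \<open>j\<close> is the dummy, with
          wisdom 0, so the tie fixes the other wisdom: at \<open>-r\<close> if the agent is
          \<open>i\<close>, at \<open>r\<close> if it is \<open>j\<close>.\<close>
        obtain k s where k: "k \<in> agents N" "?T \<subseteq> {x \<in> space \<mu>. \<psi> k x = s}"
        proof (cases "i \<in> agents N")
          case True
          with ij False show ?thesis
            by (intro that[of i "-r"]) (auto simp: extended_wisdom_def)
        next
          case i: False
          with ij False have "j \<in> agents N" by auto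
          with ij i show ?thesis
            by (intro that[of j r]) (auto simp: extended_wisdom_def)
        qed
        from k(1) \<psi> have [measurable]: "\<psi> k \<in> borel_measurable \<mu>" by auto
        have "measure \<mu> {x \<in> space \<mu>. \<psi> k x = s} = 0"
          using st True k(1) unfolding standing_assumptions_def by metis
        then show ?thesis
          by (intro sub[OF k(2)]) measurable
      next
        case sat: False
        from False ij consider "i = Suc N" | "j = Suc N" by auto
        then show ?thesis
        proof cases
          case 1
          then show ?thesis by (intro sub[OF _ _ dummy_null[OF sat opt(1)]]) auto
        next
          case 2
          then show ?thesis by (intro sub[OF _ _ dummy_null[OF sat opt(2)]]) auto
        qed
      qed
    qed
  next
    fix c :: "'a \<Rightarrow> nat"
    assume [measurable]: "c \<in> measurable \<mu> (count_space UNIV)"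
      and half: "\<And>i. measure \<mu> {x \<in> space \<mu>. c x = i} =
        (measure \<mu> {x \<in> space \<mu>. owner N A x = i} + measure \<mu> {x \<in> space \<mu>. owner N A' x = i}) / 2"
    let ?C = "\<lambda>i. {x \<in> space \<mu>. c x = i}"
    \<comment> \<open>Averages of feasible share sizes are feasible.\<close>
    have "measure \<mu> (?C i) \<le> M i" if "i \<in> agents N" for i
    proof -
      have "measure \<mu> (A i) \<le> M i" "measure \<mu> (A' i) \<le> M i"
        using p that by (auto simp: partitions_def)
      then show ?thesis
        using half[of i] measure_owner[OF assms(1) p(1) that] measure_owner[OF assms(1) p(2) that]
        by simp
    qed
    moreover have "?C i \<inter> ?C j = {}" if "i \<noteq> j" for i j using that by auto
    ultimately have Cp: "?C \<in> partitions \<mu> N M"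
      by (auto simp: partitions_def)
    have "(\<Sum>i\<in>agents N. individual_value \<mu> \<psi> ?C i) = (LINT x|\<mu>. ?\<phi> (c x) x)"
      using \<psi> by (intro total_value_eq_integral) auto
    \<comment> \<open>Both integrals on the right equal the optimal total value, and so does their
      average.\<close>
    with Cp opt show "(LINT x|\<mu>. ?\<phi> (c x) x) \<le>
        ((LINT x|\<mu>. ?\<phi> (owner N A x) x) + (LINT x|\<mu>. ?\<phi> (owner N A' x) x)) / 2"
      unfolding optimal_partition_def val[OF p(1), symmetric] val[OF p(2), symmetric]
      by fastforce
  qed (use \<phi>int owner_cases[of N A] owner_cases[of N A'] in auto)
  with AE_mem_iff_owner[OF assms(1) p(1)] AE_mem_iff_owner[OF assms(1) p(2)]
  show ?thesis by eventually_elim auto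
qed

section \<open>Comparison of the two systems\<close>

lemma wisdom_system_integrable:
  fixes \<mu> :: "'a::t2_space measure"
  assumes "compact (UNIV :: 'a set)" and "finite_measure \<mu>" and "sets \<mu> = sets borel"
    and "wisdom_system N \<psi> M" and "i \<in> agents N"
  shows "integrable \<mu> (\<psi> i)"
proof -
  interpret finite_measure \<mu> by fact
  have cont: "continuous_on UNIV (\<psi> i)"
    using assms(4,5) by (simp add: wisdom_system_def)
  then have "compact (range (\<psi> i))"
    using assms(1) by (rule compact_continuous_image)
  then have "bounded (range (\<psi> i))"
    by (rule compact_imp_bounded)
  then obtain K where K: "\<And>x. norm (\<psi> i x) \<le> K"
    by (auto simp: bounded_iff)
  have "\<psi> i \<in> borel_measurable \<mu>"
    unfolding measurable_cong_sets[OF assms(3) refl] using cont by (rule borel_measurable_continuous_onI)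
  with K show ?thesis
    by (intro integrable_const_bound[where B=K]) auto
qed

text \<open>On a fixed partition only the term of \<open>k\<close> changes, so inequalities between
  total values of the two systems reduce to agent \<open>k\<close>.\<close>

lemma total_value_diff:
  assumes "k \<in> agents N" and "\<And>i. i \<in> agents N \<Longrightarrow> i \<noteq> k \<Longrightarrow> \<psi>' i = \<psi> i"
  shows "(\<Sum>i\<in>agents N. individual_value \<mu> \<psi>' B i) - (\<Sum>i\<in>agents N. individual_value \<mu> \<psi> B i) =
    individual_value \<mu> \<psi>' B k - individual_value \<mu> \<psi> B k"
proof -
  have "(\<Sum>i\<in>agents N - {k}. individual_value \<mu> \<psi>' B i) = (\<Sum>i\<in>agents N - {k}. individual_value \<mu> \<psi> B i)"
    using assms(2) by (intro sum.cong) (auto simp: individual_value_def)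
  then show ?thesis
    using assms(1) by (simp add: sum.remove[of _ k])
qed

theorem theorem2:
  fixes \<mu> :: "'a::t2_space measure"
    and N :: nat
    and M :: "nat \<Rightarrow> real"
    and \<psi> \<psi>' :: "nat \<Rightarrow> 'a \<Rightarrow> real"
    and A A' :: "nat \<Rightarrow> 'a set"
  assumes "compact (UNIV :: 'a set)"
    and "prob_space \<mu>" and "sets \<mu> = sets borel"
    and "1 \<in> agents N"
    and "wisdom_system N \<psi> M" and "standing_assumptions \<mu> N \<psi> M"
    and "wisdom_system N \<psi>' M" and "standing_assumptions \<mu> N \<psi>' M"
    and "\<And>i. i \<in> agents N \<Longrightarrow> i \<noteq> 1 \<Longrightarrow> \<psi>' i = \<psi> i"
    and "optimal_partition \<mu> N \<psi> M A"
    and "optimal_partition \<mu> N \<psi>' M A'"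
  shows "(\<forall>\<beta>>0. (\<forall>x. \<psi>' 1 x = \<beta> * \<psi> 1 x) \<longrightarrow>
            (\<beta> > 1 \<longrightarrow> individual_value \<mu> \<psi>' A' 1 \<ge> \<beta> * individual_value \<mu> \<psi> A 1) \<and>
            (\<beta> < 1 \<longrightarrow> individual_value \<mu> \<psi>' A' 1 \<le> \<beta> * individual_value \<mu> \<psi> A 1)) \<and>
         (total_capacity N M \<le> measure \<mu> (space \<mu>) \<longrightarrow>
          (\<forall>\<Lambda>>0. (\<forall>x. \<psi>' 1 x = \<psi> 1 x + \<Lambda>) \<longrightarrow>
            individual_value \<mu> \<psi>' A' 1 = individual_value \<mu> \<psi> A 1 + \<Lambda> * M 1))"
proof -
  interpret prob_space \<mu> by fact
  have fm: "finite_measure \<mu>" by unfold_locales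
  note int = wisdom_system_integrable[OF assms(1) fm assms(3) assms(5)]
  note int' = wisdom_system_integrable[OF assms(1) fm assms(3) assms(7)]
  have p: "A \<in> partitions \<mu> N M" "A' \<in> partitions \<mu> N M"
    using assms(10,11) by (auto simp: optimal_partition_def)
  note diff = total_value_diff[OF assms(4), of \<psi>' \<psi>, OF assms(9)]
  have opt: "(\<Sum>i\<in>agents N. individual_value \<mu> \<psi> A' i) \<le> (\<Sum>i\<in>agents N. individual_value \<mu> \<psi> A i)"
    using assms(10) p by (simp add: optimal_partition_def)
  have opt': "(\<Sum>i\<in>agents N. individual_value \<mu> \<psi>' A i) \<le> (\<Sum>i\<in>agents N. individual_value \<mu> \<psi>' A' i)"
    using assms(11) p by (simp add: optimal_partition_def)
  show ?thesis
  proof (intro conjI allI impI)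
    fix \<beta> :: real assume "\<beta> > 0" and \<beta>: "\<forall>x. \<psi>' 1 x = \<beta> * \<psi> 1 x"
    have scale: "individual_value \<mu> \<psi>' B 1 = \<beta> * individual_value \<mu> \<psi> B 1" for B
      by (simp only: individual_value_def \<beta> set_integral_mult_right)
    \<comment> \<open>Adding both optimality inequalities shows that passing from
      \<open>\<psi>\<close> to \<open>\<psi>'\<close> changes the total value of \<open>A'\<close>
      by at least as much as that of \<open>A\<close>. The sign of \<open>\<beta> - 1\<close> then
      decides the direction.\<close>
    have "(\<beta> - 1) * individual_value \<mu> \<psi> A 1 \<le> (\<beta> - 1) * individual_value \<mu> \<psi> A' 1"
      using diff[of \<mu> A] diff[of \<mu> A'] opt opt' unfolding scale by (simp add: left_diff_distrib)
    then show "individual_value \<mu> \<psi>' A' 1 \<ge> \<beta> * individual_value \<mu> \<psi> A 1" if "\<beta> > 1"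
      using that \<open>\<beta> > 0\<close> unfolding scale by simp
    show "individual_value \<mu> \<psi>' A' 1 \<le> \<beta> * individual_value \<mu> \<psi> A 1" if "\<beta> < 1"
      using that \<open>\<beta> > 0\<close> \<open>(\<beta> - 1) * _ \<le> _\<close> unfolding scale by (simp add: mult_le_cancel_left)
  next
    fix \<Lambda> :: real
    assume tot: "total_capacity N M \<le> measure \<mu> (space \<mu>)"
      and "\<Lambda> > 0" and \<Lambda>: "\<forall>x. \<psi>' 1 x = \<psi> 1 x + \<Lambda>"
    have A1: "A 1 \<in> sets \<mu>" "A' 1 \<in> sets \<mu>"
      using p assms(4) by (auto simp: partitions_def)
    have shift: "individual_value \<mu> \<psi>' B 1 = individual_value \<mu> \<psi> B 1 + \<Lambda> * measure \<mu> (B 1)"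
      if "B 1 \<in> sets \<mu>" for B
    proof -
      have "set_integrable \<mu> (B 1) (\<psi> 1)" "set_integrable \<mu> (B 1) (\<lambda>x. \<Lambda>)"
        unfolding set_integrable_def
        by (rule integrable_mult_indicator[OF that int[OF assms(4)]],
            rule integrable_mult_indicator[OF that integrable_const])
      then show ?thesis
        using that
        by (simp only: individual_value_def \<Lambda> set_integral_add)
          (simp add: set_lebesgue_integral_def Int_absorb2 sets.sets_into_space)
    qed
    have full: "measure \<mu> (A 1) = M 1" "measure \<mu> (A' 1) = M 1"
      using optimal_partition_exhausts_capacity[OF fm int assms(6) assms(10) tot assms(4)]
        optimal_partition_exhausts_capacity[OF fm int' assms(8) assms(11) tot assms(4)] by auto
    \<comment> \<open>Both partitions give agent 1 the full capacity, so the shift adds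
      \<open>\<Lambda> * M 1\<close> to each total and cancels from the optimality of
      \<open>A'\<close>.\<close>
    have "(\<Sum>i\<in>agents N. individual_value \<mu> \<psi> A i) \<le> (\<Sum>i\<in>agents N. individual_value \<mu> \<psi> A' i)"
      using diff[of \<mu> A] diff[of \<mu> A'] opt' shift[of A] shift[of A'] A1 full by simp
    then have "optimal_partition \<mu> N \<psi> M A'"
      using assms(10) p unfolding optimal_partition_def by (meson order_trans)
    then have "AE x in \<mu>. \<forall>i\<in>agents N. x \<in> A i \<longleftrightarrow> x \<in> A' i"
      by (intro optimal_partitions_AE_eq[OF fm int assms(6) assms(10) _ tot])
    then have ae: "AE x in \<mu>. x \<in> A 1 \<longleftrightarrow> x \<in> A' 1"
      by eventually_elim (use assms(4) in auto)
    have [measurable]: "\<psi> 1 \<in> borel_measurable \<mu>"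
      using int[OF assms(4)] by auto
    have "individual_value \<mu> \<psi> A 1 = individual_value \<mu> \<psi> A' 1"
      unfolding individual_value_def set_lebesgue_integral_def
    proof (rule integral_cong_AE)
      show "AE x in \<mu>. indicat_real (A 1) x *\<^sub>R \<psi> 1 x = indicat_real (A' 1) x *\<^sub>R \<psi> 1 x"
        using ae by eventually_elim (auto simp: indicator_def)
    qed (use A1 in measurable)
    then show "individual_value \<mu> \<psi>' A' 1 = individual_value \<mu> \<psi> A 1 + \<Lambda> * M 1"
      using shift[of A'] A1 full by simp
  qed
qed

end
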